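(* Let $f:\mathbb{P}^1\to\mathbb{P}^1$ be a rational map over $\mathbb{C}$ of degree $d>1$ for which there exist an integer $k\ge 1$, a constant $\lambda\in\mathbb{C}^*$ and a nonzero global meromorphic section $q$ of $\Omega_{\mathbb{P}^1}^{\otimes k}$ with $f^*q=\lambda q$. Then $f$ preserves one of the following parabolic orbifolds (resp. orbifolds with boundary): (i) $(\infty,\infty)$; (ii) $(2,2,\infty)$; (iii) $(2,2,2,2)$; (iv) $(3,3,3)$; (v) $(2,4,4)$; (vi) $(2,3,6)$.
   Context: $\Omega_{\mathbb{P}^1}$ is the sheaf of holomorphic differential forms on $\mathbb{P}^1$; a meromorphic section of $\Omega_{\mathbb{P}^1}^{\otimes k}$ is locally $q(z)\,dz^k$ with $q(z)$ meromorphic, and $f^*(q(z)dz^k)=q(f(z))f'(z)^k\,dz^k$. Let $P_f=\bigcup_{n>0}f^n(\mathrm{Ram}_f)$ be the post-critical set of $f$, where $\mathrm{Ram}_f$ is the set of ramification (critical) points of $f$, and let $\deg_y(f)$ be the local degree of $f$ at $y$. The map $f$ preserves the orbifold $(\mathbb{P}^1,\nu)$, where $\nu:\mathbb{P}^1\to\{1,2,3,\dots\}\cup\{\infty\}$, if: 1) $\nu(x)=1$ for $x\notin P_f$; and 2) for all $x\in\mathbb{P}^1$, $\nu(x)$ divides $\nu(y)\deg_y(f)$ whenever $y\in f^{-1}(x)$ (with the conventions $\infty\cdot m=\infty$, everything divides $\infty$, and $\infty$ divides only $\infty$). The orbifold is denoted by the list of its weights different from $1$, so e.g. $(2,4,4)$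 means that $\nu$ takes value $2$ at one point, value $4$ at two points, and value $1$ elsewhere. If $\nu$ takes the value $\infty$ it is called an orbifold with boundary, the boundary being the set of points of weight $\infty$. The Euler characteristic is $\chi=2-\sum_{x}\left(1-\frac{1}{\nu(x)}\right)$ (with $1/\infty=0$), and the orbifold is parabolic if $\chi=0$. *)

theory Defs
  imports
    "HOL-Complex_Analysis.Complex_Analysis"
    "HOL-Library.Extended_Nat"
    "HOL-Library.Multiset"
begin

datatype riemann_sphere = Aff complex | Infty

text \<open>
  The degree is that of a coprime representation \<open>a / b\<close>. The value at infinity is obtained by
  homogenizing \<open>a\<close> and \<open>b\<close> to degree \<open>d\<close>.
\<close>

definition rational_map :: "nat \<Rightarrow> (riemann_sphere \<Rightarrow> riemann_sphere) \<Rightarrow> bool" where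
  "rational_map d f \<longleftrightarrow>
     (\<exists>a b :: complex poly. coprime a b \<and> d = max (degree a) (degree b) \<and>
        (\<forall>z. f (Aff z) = (if poly b z = 0 then Infty else Aff (poly a z / poly b z))) \<and>
        f Infty = (if coeff b d = 0 then Infty else Aff (coeff a d / coeff b d)))"

text \<open>
  Local coordinate centred at a point (only meaningful near that point), and its inverse.
\<close>

fun coord :: "riemann_sphere \<Rightarrow> riemann_sphere \<Rightarrow> complex" where
  "coord (Aff c) (Aff z) = z - c"
| "coord (Aff c) Infty = 0"
| "coord Infty (Aff z) = inverse z"
| "coord Infty Infty = 0"

fun param :: "riemann_sphere \<Rightarrow> complex \<Rightarrow> riemann_sphere" where
  "param (Aff c) t = Aff (c + t)"
| "param Infty t = (if t = 0 then Infty else Aff (inverse t))"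

definition local_degree :: "(riemann_sphere \<Rightarrow> riemann_sphere) \<Rightarrow> riemann_sphere \<Rightarrow> nat" where
  "local_degree f y = nat (zorder (\<lambda>t. coord (f y) (f (param y t))) 0)"

definition ramification_points :: "(riemann_sphere \<Rightarrow> riemann_sphere) \<Rightarrow> riemann_sphere set" where
  "ramification_points f = {y. local_degree f y > 1}"

definition postcritical_set :: "(riemann_sphere \<Rightarrow> riemann_sphere) \<Rightarrow> riemann_sphere set" where
  "postcritical_set f = (\<Union>n\<in>{0<..}. (f ^^ n) ` ramification_points f)"

text \<open>
  A section of the \<open>k\<close>-th power of the sheaf of differentials is given by its coefficient \<open>q\<close> in
  the chart \<open>z\<close>, where it reads \<open>q(z) dz^k\<close>. In the chart \<open>w = 1/z\<close> we have \<open>dz = - w^(-2) dw\<close>.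
\<close>

definition meromorphic_section :: "nat \<Rightarrow> (complex \<Rightarrow> complex) \<Rightarrow> bool" where
  "meromorphic_section k q \<longleftrightarrow>
     q meromorphic_on UNIV \<and>
     (\<lambda>w. q (inverse w) * (- 1 / w ^ 2) ^ k) meromorphic_on UNIV"

text \<open>
  \<^const>\<open>meromorphic_on\<close> does not constrain the values of a function at isolated points, so
  equality of sections is equality of the coefficients off a set without limit points in the plane.
\<close>

definition section_eq :: "(complex \<Rightarrow> complex) \<Rightarrow> (complex \<Rightarrow> complex) \<Rightarrow> bool" where
  "section_eq q r \<longleftrightarrow> eventually (\<lambda>z. q z = r z) (cosparse UNIV)"

fun affine_part :: "riemann_sphere \<Rightarrow> complex" where
  "affine_part (Aff z) = z"
| "affine_part Infty = 0"

text \<open>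
  For nonconstant rational \<open>f\<close> the junk value of \<^const>\<open>affine_part\<close> at the finitely many poles
  of \<open>f\<close> is invisible to \<^const>\<open>section_eq\<close>.
\<close>

definition pullback ::
  "nat \<Rightarrow> (riemann_sphere \<Rightarrow> riemann_sphere) \<Rightarrow> (complex \<Rightarrow> complex) \<Rightarrow> complex \<Rightarrow> complex" where
  "pullback k f q = (let g = (\<lambda>z. affine_part (f (Aff z))) in (\<lambda>z. q (g z) * deriv g z ^ k))"

text \<open>
  Divisibility is that of \<^typ>\<open>enat\<close>. Away from \<open>0\<close>, every element divides \<open>\<infinity>\<close> and \<open>\<infinity>\<close> divides
  only \<open>\<infinity>\<close>; weights and local degrees are nonzero.
\<close>

definition preserves_orbifold ::
  "(riemann_sphere \<Rightarrow> riemann_sphere) \<Rightarrow> (riemann_sphere \<Rightarrow> enat) \<Rightarrow> bool" where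
  "preserves_orbifold f \<nu> \<longleftrightarrow>
     (\<forall>x. \<nu> x \<ge> 1) \<and>
     (\<forall>x. x \<notin> postcritical_set f \<longrightarrow> \<nu> x = 1) \<and>
     (\<forall>x. \<forall>y \<in> f -` {x}. \<nu> x dvd \<nu> y * enat (local_degree f y))"

text \<open>
  Only meaningful when finitely many points have weight different from \<open>1\<close>; otherwise the
  multiset is empty and the characteristic is \<open>2\<close>.
\<close>

definition orbifold_weights :: "(riemann_sphere \<Rightarrow> enat) \<Rightarrow> enat multiset" where
  "orbifold_weights \<nu> = image_mset \<nu> (mset_set {x. \<nu> x \<noteq> 1})"

definition euler_characteristic :: "(riemann_sphere \<Rightarrow> enat) \<Rightarrow> real" where
  "euler_characteristic \<nu> =
     2 - (\<Sum>x | \<nu> x \<noteq> 1. 1 - (case \<nu> x of enat n \<Rightarrow> 1 / real n | \<infinity> \<Rightarrow> 0))"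

definition parabolic :: "(riemann_sphere \<Rightarrow> enat) \<Rightarrow> bool" where
  "parabolic \<nu> \<longleftrightarrow> euler_characteristic \<nu> = 0"

end

theory Submission
  imports Defs "HOL-Computational_Algebra.Fundamental_Theorem_Algebra"
begin

text \<open>
  Write \<open>ord x\<close> for the order of \<open>q\<close> at \<open>x\<close> as a section of the \<open>k\<close>-th power of the sheaf of
  differentials, and put \<open>m x = ord x + k\<close>. In local coordinates \<open>f\<close> is \<open>t \<mapsto> t^e\<close> times a unit, so
  pulling back multiplies \<open>m\<close> by the local degree: \<open>f\<^sup>*q = l q\<close> gives \<open>m y = e y * m (f y)\<close> for every
  \<open>y\<close> (\<open>section_order_pullback\<close>). A nonzero section has degree \<open>- 2 k\<close> (\<open>sum_section_order\<close>), so
  \<open>m = k\<close> off a finite set and \<open>\<Sum>x. (1 - m x / k) = 2\<close>. The orbifold is \<open>\<nu> = k / m\<close>, with weight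
  \<open>\<infinity>\<close> where \<open>m = 0\<close>: the functional equation then reads \<open>\<nu> (f y) = \<nu> y * e y\<close>, and the degree
  formula is the vanishing of the Euler characteristic.

  What has to be shown is that \<open>\<nu>\<close> takes values in \<open>{1, 2, \<dots>, \<infinity>}\<close> and that it is \<open>1\<close> off the
  postcritical set. Both follow from one observation (\<open>backward_invariant\<close>): a finite set \<open>S\<close> with
  \<open>f\<^sup>-\<^sup>1 S \<subseteq> S\<close> is permuted by \<open>f\<close>, all its points are totally ramified, and \<open>m\<close> vanishes on it.
  Applied to \<open>{m < 0}\<close> it shows \<open>m \<ge> 0\<close>. Applied to the backward orbit of a point \<open>x\<close> with
  \<open>m x > 0\<close>, it shows that this orbit contains some \<open>y\<close> with \<open>m y = k\<close>; the product of the local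
  degrees on the way from \<open>y\<close> to \<open>x\<close> is the integer \<open>k / m x\<close>, and if it is not \<open>1\<close> then a critical
  point lies on the way. Applied to \<open>{m = 0}\<close>, it shows that points of weight \<open>\<infinity>\<close> are critical
  values.

  It remains to list the multisets of weights at least \<open>2\<close> with \<open>\<Sum> (1 - 1 / \<nu>) = 2\<close>, which is
  elementary (\<open>parabolic_weights_cases\<close>).
\<close>

section \<open>The order of a meromorphic section at a point of the sphere\<close>

text \<open>
  The inverse coordinate at a point, read in the plane. At infinity the value \<open>0\<close> for \<open>t = 0\<close> is
  arbitrary.
\<close>

definition chart :: "riemann_sphere \<Rightarrow> complex \<Rightarrow> complex" where
  "chart x t = affine_part (param x t)"

lemma chart_simps [simp]: "chart (Aff c) = (\<lambda>t. c + t)" "chart Infty = inverse"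
  by (auto simp: chart_def fun_eq_iff)

text \<open>
  The coefficient of the section \<open>q(z) dz^k\<close> in the local coordinate at \<open>x\<close>, that is, of its
  pullback along the chart.
\<close>

definition local_coeff :: "nat \<Rightarrow> (complex \<Rightarrow> complex) \<Rightarrow> riemann_sphere \<Rightarrow> complex \<Rightarrow> complex" where
  "local_coeff k q x t = q (chart x t) * deriv (chart x) t ^ k"

lemma has_field_derivative_chart:
  assumes "t \<noteq> 0"
  shows "(chart x has_field_derivative deriv (chart x) t) (at t)"
proof -
  have "\<exists>D. (chart x has_field_derivative D) (at t)"
    using assms by (cases x) (auto intro!: derivative_eq_intros exI)
  thus ?thesis by (metis DERIV_imp_deriv)
qed

lemma local_coeff_Aff [simp]: "local_coeff k q (Aff c) t = q (c + t)"
proof -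
  have "deriv (\<lambda>t. c + t) t = 1" by (rule DERIV_imp_deriv) (auto intro!: derivative_eq_intros)
  thus ?thesis by (simp add: local_coeff_def)
qed

lemma local_coeff_Infty:
  assumes "t \<noteq> 0"
  shows "local_coeff k q Infty t = q (inverse t) * (- 1 / t ^ 2) ^ k"
proof -
  have "deriv inverse t = - 1 / t ^ 2"
    using assms by (intro DERIV_imp_deriv) (auto intro!: derivative_eq_intros simp: power2_eq_square field_simps)
  thus ?thesis by (simp add: local_coeff_def)
qed

definition section_order :: "nat \<Rightarrow> (complex \<Rightarrow> complex) \<Rightarrow> riemann_sphere \<Rightarrow> int" where
  "section_order k q x = zorder (local_coeff k q x) 0"

lemma section_order_Aff: "section_order k q (Aff c) = zorder q c"
proof -
  have "local_coeff k q (Aff c) = (\<lambda>t. q (t + c))" by (simp add: fun_eq_iff add.commute)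
  thus ?thesis unfolding section_order_def using zorder_shift[of q c] by simp
qed

text \<open>
  Inversion is an involution, so \<open>g\<close> is its own double composite with it; this carries statements
  about a punctured neighbourhood of infinity over from a punctured neighbourhood of \<open>0\<close>.
\<close>

lemma analytic_at_if_compose_inverse:
  fixes g :: "complex \<Rightarrow> complex"
  assumes "z \<noteq> 0" "(\<lambda>w. g (inverse w)) analytic_on {inverse z}"
  shows "g analytic_on {z}"
proof -
  have "(\<lambda>w. g (inverse w)) \<circ> inverse analytic_on {z}"
    using assms by (intro analytic_on_compose analytic_intros) auto
  thus ?thesis by (simp add: o_def)
qed

lemma eventually_analytic_at:
  assumes "g meromorphic_on {z}"
  shows "eventually (\<lambda>w. g analytic_on {w}) (at z)"
  using assms isolated_singularity_at_altdef[of g z]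
  by (simp add: meromorphic_at_iff)

lemma filterlim_inverse_at: "z \<noteq> (0 :: complex) \<Longrightarrow> filterlim inverse (at (inverse z)) (at z)"
  unfolding filterlim_at
  by (auto simp: eventually_at_filter intro!: tendsto_eq_intros always_eventually)

lemma zorder_linear: "zorder (\<lambda>z. z - c) z0 = (if z0 = c then 1 else 0)"
proof (cases "z0 = c")
  case True
  show ?thesis unfolding True by (rule zorder_eqI[of UNIV _ "\<lambda>_. 1"]) auto
next
  case False
  have "zorder (\<lambda>z. z - c) z0 = 0"
    by (rule zorder_eqI[of UNIV _ "\<lambda>z. z - c"]) (use False in \<open>auto intro!: holomorphic_intros\<close>)
  thus ?thesis using False by simp
qed

lemma zorder_linear_inverse: "zorder (\<lambda>w. inverse w - c) (0 :: complex) = -1"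
  by (rule zorder_eqI[of UNIV _ "\<lambda>w. 1 - c * w"])
     (auto intro!: holomorphic_intros simp: field_simps power_int_minus)

lemma eventually_linear_inverse_nonzero: "eventually (\<lambda>w. inverse w - c \<noteq> 0) (at (0 :: complex))"
proof -
  have "eventually (\<lambda>w. w \<in> - {inverse c} - {0}) (at (0 :: complex))" if "c \<noteq> 0"
    using that by (intro eventually_at_in_open) auto
  moreover have "eventually (\<lambda>w. w \<noteq> 0) (at (0::complex))" by (simp add: eventually_at_filter)
  ultimately show ?thesis
    by (cases "c = 0") (auto elim!: eventually_mono)
qed

text \<open>
  After removing its singularities such a function is entire without zeros. A positive order at
  infinity would make it tend to \<open>0\<close> there, hence vanish by Liouville's theorem.
\<close>

lemma zorder_at_infinity_nonpos:
  assumes mero: "h meromorphic_on UNIV" and ord: "\<And>z. zorder h z = 0"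
    and nz: "\<And>z. eventually (\<lambda>z. h z \<noteq> 0) (at z)"
    and inf: "(\<lambda>w. h (inverse w)) meromorphic_on {0}"
    and nz_inf: "eventually (\<lambda>w. h (inverse w) \<noteq> 0) (at 0)"
  shows "zorder (\<lambda>w. h (inverse w)) 0 \<le> 0"
proof (rule ccontr)
  assume "\<not> ?thesis"
  hence "isolated_zero (\<lambda>w. h (inverse w)) 0"
    using inf nz_inf by (intro zorder_pos_imp_isolated_zero) auto
  hence lim: "(\<lambda>w. h (inverse w)) \<midarrow>0\<rightarrow> 0" by (simp add: isolated_zero_def)
  have sing: "isolated_singularity_at h z" "not_essential h z" for z
    using mero by (auto simp: meromorphic_on_altdef)
  have no_pole: "\<not> is_pole h z" and no_zero: "\<not> isolated_zero h z" for z
    using isolated_pole_imp_neg_zorder[OF sing(1)] zorder_isolated_zero_pos'[OF _ sing(1)] ord[of z]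
    by force+
  define g where "g = remove_sings h"
  have g_analytic: "g analytic_on {z}" for z
    unfolding g_def using remove_sings_analytic_at sing no_pole by (metis not_essential_def)
  hence holo: "g holomorphic_on UNIV"
    using analytic_imp_holomorphic analytic_on_analytic_at by blast
  \<comment> \<open>\<open>g\<close> and \<open>h\<close> differ on a closed discrete subset of the plane, which could a priori be unbounded;
      it is bounded because \<open>h\<close> has an isolated singularity at infinity.\<close>
  have ev: "eventually (\<lambda>w. g (inverse w) = h (inverse w)) (at 0)"
  proof -
    have "eventually (\<lambda>w. w \<noteq> 0) (at (0 :: complex))" by (simp add: eventually_at_filter)
    with eventually_analytic_at[OF inf] show ?thesis
    proof eventually_elim
      case (elim w)
      hence "h analytic_on {inverse w}" using analytic_at_if_compose_inverse[of "inverse w" h] by simp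
      thus ?case unfolding g_def by simp
    qed
  qed
  have "(\<lambda>w. g (inverse w)) \<midarrow>0\<rightarrow> 0" using lim by (simp only: tendsto_cong[OF ev])
  hence "(g \<longlongrightarrow> 0) at_infinity" by (simp add: lim_at_infinity_0 o_def)
  hence "g = (\<lambda>_. 0)" using Liouville_weak_0 holo by blast
  hence "g \<midarrow>0\<rightarrow> 0" by simp
  hence "h \<midarrow>0\<rightarrow> 0" unfolding g_def using sing by simp
  hence "isolated_zero h 0" using nz[of 0] by (simp add: isolated_zero_def)
  thus False using no_zero by blast
qed

text \<open>The bound applies to \<open>h\<close> and to \<open>1 / h\<close>.\<close>

lemma zorder_at_infinity_eq_0:
  assumes mero: "h meromorphic_on UNIV" and ord: "\<And>z. zorder h z = 0"
    and nz: "\<And>z. eventually (\<lambda>z. h z \<noteq> 0) (at z)"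
    and inf: "(\<lambda>w. h (inverse w)) meromorphic_on {0}"
    and nz_inf: "eventually (\<lambda>w. h (inverse w) \<noteq> 0) (at 0)"
  shows "zorder (\<lambda>w. h (inverse w)) 0 = 0"
proof (rule antisym)
  show "zorder (\<lambda>w. h (inverse w)) 0 \<le> 0" using assms by (rule zorder_at_infinity_nonpos)
  have zi: "zorder (\<lambda>z. inverse (g z)) z = - zorder g z"
    if "g meromorphic_on {z}" "eventually (\<lambda>z. g z \<noteq> 0) (at z)" for g z
    using that by (intro zorder_inverse) (auto simp: meromorphic_at_iff eventually_frequently)
  have "zorder (\<lambda>w. inverse (h (inverse w))) 0 \<le> 0"
  proof (rule zorder_at_infinity_nonpos[of "\<lambda>z. inverse (h z)"])
    show "zorder (\<lambda>z. inverse (h z)) z = 0" for z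
      using zi[of h z] nz[of z] ord[of z] meromorphic_on_subset[OF mero] by simp
  qed (use assms in \<open>auto intro!: meromorphic_intros\<close>)
  thus "zorder (\<lambda>w. h (inverse w)) 0 \<ge> 0" using zi[OF inf nz_inf] by simp
qed

locale nonzero_section =
  fixes k :: nat and q :: "complex \<Rightarrow> complex"
  assumes mero: "meromorphic_section k q" and nonzero: "\<not> section_eq q (\<lambda>_. 0)"
begin

lemma q_meromorphic: "q meromorphic_on A"
  using mero meromorphic_on_subset unfolding meromorphic_section_def by blast

lemma eventually_q_nonzero: "eventually (\<lambda>z. q z \<noteq> 0) (at c)"
proof -
  have "(\<forall>\<^sub>\<approx>z\<in>UNIV. q z = 0) \<or> (\<forall>\<^sub>\<approx>z\<in>UNIV. q z \<noteq> 0)"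
    by (intro meromorphic_imp_constant_or_avoid q_meromorphic) auto
  thus ?thesis using nonzero eventually_cosparse_imp_eventually_at[of _ UNIV c]
    unfolding section_eq_def by blast
qed

text \<open>
  Agrees with the local coefficient at infinity off \<open>0\<close>, and is the expression whose
  meromorphy \<^const>\<open>meromorphic_section\<close> demands.
\<close>

abbreviation coeff_infty :: "complex \<Rightarrow> complex" where
  "coeff_infty w \<equiv> q (inverse w) * (- 1 / w ^ 2) ^ k"

lemma local_coeff_Infty_ev: "eventually (\<lambda>w. local_coeff k q Infty w = coeff_infty w) (at 0)"
  by (auto simp: eventually_at_filter local_coeff_Infty)

lemma coeff_infty_meromorphic: "coeff_infty meromorphic_on A"
  using mero meromorphic_on_subset unfolding meromorphic_section_def by blast

text \<open>
  If the coefficient vanished near infinity, then by the identity theorem in the coordinate \<open>w\<close> it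
  would vanish near \<open>w = 1\<close>, where both charts are defined.
\<close>

lemma eventually_coeff_infty_nonzero: "eventually (\<lambda>w. coeff_infty w \<noteq> 0) (at 0)"
proof -
  have alt: "(\<forall>\<^sub>\<approx>w\<in>UNIV. coeff_infty w = 0) \<or> (\<forall>\<^sub>\<approx>w\<in>UNIV. coeff_infty w \<noteq> 0)"
    by (intro meromorphic_imp_constant_or_avoid coeff_infty_meromorphic) auto
  have "eventually (\<lambda>w. q (inverse w) \<noteq> 0) (at 1)"
    using filterlim_inverse_at[of 1] eventually_q_nonzero[of 1] eventually_compose_filterlim by fastforce
  moreover have "eventually (\<lambda>w. w \<in> - {0} - {1}) (at (1 :: complex))"
    by (intro eventually_at_in_open) auto
  ultimately have "eventually (\<lambda>w. coeff_infty w \<noteq> 0) (at 1)" by eventually_elim auto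
  hence "\<not> eventually (\<lambda>w. coeff_infty w = 0) (at 1)"
    by (metis eventually_frequently frequently_def at_neq_bot)
  hence "\<not> (\<forall>\<^sub>\<approx>w\<in>UNIV. coeff_infty w = 0)"
    using eventually_cosparse_imp_eventually_at by blast
  thus ?thesis using alt eventually_cosparse_imp_eventually_at[of _ UNIV 0] by blast
qed

lemma local_coeff_meromorphic: "local_coeff k q x meromorphic_on {0}"
proof (cases x)
  case (Aff c)
  have "(\<lambda>t. q (c + t)) meromorphic_on {0}"
    by (rule meromorphic_on_compose[OF q_meromorphic[of UNIV]]) (auto intro!: analytic_intros)
  moreover have "local_coeff k q x = (\<lambda>t. q (c + t))" by (simp add: Aff fun_eq_iff)
  ultimately show ?thesis by simp
next
  case Infty
  have "local_coeff k q x meromorphic_on {0} \<longleftrightarrow> coeff_infty meromorphic_on {0}"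
    using local_coeff_Infty_ev unfolding Infty by (intro meromorphic_on_cong) auto
  thus ?thesis using coeff_infty_meromorphic by blast
qed

lemma eventually_local_coeff_nonzero: "eventually (\<lambda>t. local_coeff k q x t \<noteq> 0) (at 0)"
proof (cases x)
  case (Aff c)
  have "eventually (\<lambda>t. q (c + t) \<noteq> 0) (at 0)"
    using eventually_q_nonzero[of c] by (simp add: at_to_0' eventually_filtermap add.commute)
  thus ?thesis by (simp add: Aff)
next
  case Infty
  show ?thesis using local_coeff_Infty_ev eventually_coeff_infty_nonzero unfolding Infty
    by eventually_elim simp
qed

text \<open>
  The zeros and poles in the plane do not accumulate there, and those in the chart at infinity do
  not accumulate at infinity, so they lie in a compact set.
\<close>

lemma finite_zeros_poles: "finite {c. zorder q c \<noteq> 0}"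
proof -
  have "eventually (\<lambda>w. coeff_infty w \<noteq> 0 \<and> coeff_infty analytic_on {w}) (at 0)"
    using eventually_coeff_infty_nonzero eventually_analytic_at[OF coeff_infty_meromorphic]
    by eventually_elim auto
  then obtain r where r: "r > 0"
    "\<And>w. w \<noteq> 0 \<Longrightarrow> norm w < r \<Longrightarrow> coeff_infty w \<noteq> 0 \<and> coeff_infty analytic_on {w}"
    unfolding eventually_at by (auto simp: dist_norm)
  have bounded: "zorder q c = 0" if "norm c > inverse r" for c
  proof -
    have c: "c \<noteq> 0" using that r by auto
    have norm: "norm (inverse c) < r" using less_imp_inverse_less[OF that] r(1) by (simp add: norm_inverse)
    have an: "(\<lambda>w. coeff_infty w * (- (w ^ 2)) ^ k) analytic_on {inverse c}"
    proof (rule analytic_on_mult)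
      show "coeff_infty analytic_on {inverse c}" using r(2)[of "inverse c"] norm c by simp
    qed (intro analytic_intros)
    have ev: "eventually (\<lambda>w. coeff_infty w * (- (w ^ 2)) ^ k = q (inverse w)) (nhds (inverse c))"
    proof -
      have "eventually (\<lambda>w. w \<in> - {0 :: complex}) (nhds (inverse c))"
        using c by (intro eventually_nhds_in_open) auto
      thus ?thesis by eventually_elim (simp add: field_simps flip: power_mult_distrib)
    qed
    have "(\<lambda>w. q (inverse w)) analytic_on {inverse c}"
      using an analytic_at_cong[OF ev refl] by blast
    hence "q analytic_on {c}" using c analytic_at_if_compose_inverse by blast
    moreover have "q c \<noteq> 0" using r(2)[of "inverse c"] norm c by auto
    ultimately show ?thesis by (rule zorder_eq_0I)
  qed
  have "eventually (\<lambda>c. zorder q c = 0) (cosparse UNIV)"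
    using meromorphic_on_imp_not_pole_cosparse[OF q_meromorphic]
      meromorphic_on_imp_not_zero_cosparse[OF q_meromorphic]
  proof eventually_elim
    case (elim c)
    thus ?case using eventually_q_nonzero[of c]
      by (intro not_pole_not_isolated_zero_imp_zorder_eq_0 q_meromorphic) (auto simp: eventually_frequently)
  qed
  hence "{c. zorder q c \<noteq> 0} sparse_in cball 0 (inverse r)"
    using sparse_in_subset[of _ UNIV] by (auto simp: eventually_cosparse)
  hence "finite (cball 0 (inverse r) \<inter> {c. zorder q c \<noteq> 0})"
    by (rule sparse_in_compact_finite) auto
  moreover have "{c. zorder q c \<noteq> 0} \<subseteq> cball 0 (inverse r)"
    using bounded by (force simp: not_less)
  ultimately show ?thesis by (simp add: Int_absorb1)
qed

lemma section_order_support: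
  "{x. section_order k q x \<noteq> 0} \<subseteq> insert Infty (Aff ` {c. zorder q c \<noteq> 0})"
proof
  fix x assume "x \<in> {x. section_order k q x \<noteq> 0}"
  thus "x \<in> insert Infty (Aff ` {c. zorder q c \<noteq> 0})"
    by (cases x) (auto simp: section_order_Aff)
qed

lemma finite_section_order: "finite {x. section_order k q x \<noteq> 0}"
  using finite_subset[OF section_order_support] finite_zeros_poles by blast

text \<open>The shift by \<open>2 k\<close> comes from the double pole of \<open>dz = - w^(-2) dw\<close> at infinity.\<close>

lemma section_order_Infty: "zorder (\<lambda>w. q (inverse w)) 0 = section_order k q Infty + 2 * int k"
  and q_inverse_meromorphic: "(\<lambda>w. q (inverse w)) meromorphic_on {0}"
proof -
  have ev: "eventually (\<lambda>w. q (inverse w) = coeff_infty w * (- (w ^ 2)) ^ k) (at 0)"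
    unfolding eventually_at_filter
    by (intro always_eventually) (simp add: field_simps flip: power_mult_distrib)
  have mero': "(\<lambda>w. coeff_infty w * (- (w ^ 2)) ^ k) meromorphic_on {0}"
    by (intro meromorphic_intros coeff_infty_meromorphic)
  moreover have "(\<lambda>w. q (inverse w)) meromorphic_on {0} \<longleftrightarrow>
      (\<lambda>w. coeff_infty w * (- (w ^ 2)) ^ k) meromorphic_on {0}"
    by (rule meromorphic_on_cong) (use ev in blast)+
  ultimately show "(\<lambda>w. q (inverse w)) meromorphic_on {0}" by blast
  have powi: "w powi (2 * int k) = (w ^ 2) ^ k" for w :: complex
    using power_int_of_nat[of w "2 * k"] by (simp only: power_mult of_nat_mult of_nat_numeral)
  have zord: "zorder (\<lambda>w::complex. (- (w ^ 2)) ^ k) 0 = 2 * int k"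
  proof (rule zorder_eqI[of UNIV _ "\<lambda>_. (-1) ^ k"])
    fix w :: complex
    show "(- (w ^ 2)) ^ k = (- 1) ^ k * (w - 0) powi (2 * int k)"
      unfolding diff_0_right powi by (rule power_minus)
  qed auto
  have "zorder (\<lambda>w. q (inverse w)) 0 = zorder (\<lambda>w. coeff_infty w * (- (w ^ 2)) ^ k) 0"
    by (rule zorder_cong[OF ev refl])
  also have "\<dots> = zorder coeff_infty 0 + zorder (\<lambda>w. (- (w ^ 2)) ^ k) 0"
  proof (rule zorder_mult)
    have "eventually (\<lambda>w::complex. (- (w ^ 2)) ^ k \<noteq> 0) (at 0)"
      unfolding eventually_at_filter by (intro always_eventually) simp
    thus "\<exists>\<^sub>F w::complex in at 0. (- (w ^ 2)) ^ k \<noteq> 0" by (rule eventually_frequently[rotated]) simp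
    show "\<exists>\<^sub>F w in at 0. coeff_infty w \<noteq> 0"
      using eventually_coeff_infty_nonzero by (rule eventually_frequently[rotated]) simp
  qed (intro meromorphic_intros coeff_infty_meromorphic)+
  also have "zorder coeff_infty 0 = section_order k q Infty"
    unfolding section_order_def using local_coeff_Infty_ev
    by (intro zorder_cong) (auto elim!: eventually_mono)
  finally show "zorder (\<lambda>w. q (inverse w)) 0 = section_order k q Infty + 2 * int k"
    using zord by simp
qed

text \<open>
  The section \<open>dz^k\<close> has degree \<open>- 2 k\<close>, and dividing \<open>q\<close> by the rational function \<open>R\<close> with the same
  zeros and poles in the plane leaves a function that has order \<open>0\<close> at infinity by Liouville's
  theorem; there \<open>R\<close> has order minus its degree.
\<close>

lemma sum_section_order:
  "(\<Sum>x | section_order k q x \<noteq> 0. section_order k q x) = - 2 * int k"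
proof -
  define S where "S = {c. zorder q c \<noteq> 0}"
  have fin: "finite S" unfolding S_def by (rule finite_zeros_poles)
  define R where "R = (\<lambda>z. \<Prod>c\<in>S. (z - c) powi zorder q c)"
  have lin: "eventually (\<lambda>z. z - c \<noteq> 0) (at z0)" for c z0 :: complex
    using eventually_neq_at_within[of c z0 UNIV] by eventually_elim auto
  have R_mero: "R meromorphic_on A" for A unfolding R_def by (intro meromorphic_intros)
  have R_nz: "eventually (\<lambda>z. R z \<noteq> 0) (at z0)" for z0
  proof -
    have "eventually (\<lambda>z. \<forall>c\<in>S. z - c \<noteq> 0) (at z0)"
      using fin lin by (auto simp: eventually_ball_finite)
    thus ?thesis by eventually_elim (use fin in \<open>auto simp: R_def\<close>)
  qed
  have R_ord: "zorder R z0 = zorder q z0" for z0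
  proof -
    have "zorder R z0 = (\<Sum>c\<in>S. zorder (\<lambda>z. (z - c) powi zorder q c) z0)"
      unfolding R_def
      by (intro zorder_prod eventually_frequently R_nz[unfolded R_def] meromorphic_intros
           at_neq_bot fin)
    also have "\<dots> = (\<Sum>c\<in>S. zorder q c * zorder (\<lambda>z. z - c) z0)"
      by (intro sum.cong zorder_power_int eventually_frequently lin meromorphic_intros refl
            at_neq_bot)
    also have "\<dots> = (\<Sum>c\<in>S. if c = z0 then zorder q c else 0)"
      by (intro sum.cong) (auto simp: zorder_linear)
    also have "\<dots> = zorder q z0" using fin by (simp add: S_def)
    finally show ?thesis .
  qed
  have Ri_mero: "(\<lambda>w. R (inverse w)) meromorphic_on {0}" unfolding R_def by (intro meromorphic_intros)
  have Ri_nz: "eventually (\<lambda>w. R (inverse w) \<noteq> 0) (at 0)"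
  proof -
    have "eventually (\<lambda>w. \<forall>c\<in>S. inverse w - c \<noteq> 0) (at 0)"
      using fin eventually_linear_inverse_nonzero by (auto simp: eventually_ball_finite)
    thus ?thesis by eventually_elim (use fin in \<open>auto simp: R_def\<close>)
  qed
  have Ri_ord: "zorder (\<lambda>w. R (inverse w)) 0 = - (\<Sum>c\<in>S. zorder q c)"
  proof -
    have "zorder (\<lambda>w. R (inverse w)) 0 = (\<Sum>c\<in>S. zorder (\<lambda>w. (inverse w - c) powi zorder q c) 0)"
      unfolding R_def
      by (intro zorder_prod eventually_frequently Ri_nz[unfolded R_def] meromorphic_intros
           at_neq_bot fin)
    also have "\<dots> = (\<Sum>c\<in>S. zorder q c * zorder (\<lambda>w. inverse w - c) 0)"
      by (intro sum.cong zorder_power_int eventually_frequently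
            eventually_linear_inverse_nonzero meromorphic_intros refl at_neq_bot)
    also have "\<dots> = - (\<Sum>c\<in>S. zorder q c)" by (simp add: zorder_linear_inverse sum_negf)
    finally show ?thesis .
  qed
  have qi_nz: "eventually (\<lambda>w. q (inverse w) \<noteq> 0) (at 0)"
    using eventually_coeff_infty_nonzero by eventually_elim auto
  have "zorder (\<lambda>w. q (inverse w) / R (inverse w)) 0 = 0"
  proof (rule zorder_at_infinity_eq_0[of "\<lambda>z. q z / R z"])
    show "zorder (\<lambda>z. q z / R z) z = 0" for z
      using R_ord[of z] eventually_q_nonzero[of z] R_nz[of z]
      by (subst zorder_divide) (auto intro!: q_meromorphic R_mero eventually_frequently)
    show "eventually (\<lambda>z. q z / R z \<noteq> 0) (at z)" for z
      using eventually_q_nonzero[of z] R_nz[of z] by eventually_elim auto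
    show "eventually (\<lambda>w. q (inverse w) / R (inverse w) \<noteq> 0) (at 0)"
      using qi_nz Ri_nz by eventually_elim auto
  qed (auto intro!: meromorphic_intros q_meromorphic R_mero q_inverse_meromorphic Ri_mero)
  moreover have "zorder (\<lambda>w. q (inverse w) / R (inverse w)) 0 =
      zorder (\<lambda>w. q (inverse w)) 0 - zorder (\<lambda>w. R (inverse w)) 0"
    using qi_nz Ri_nz
    by (intro zorder_divide q_inverse_meromorphic Ri_mero eventually_frequently) auto
  ultimately have "section_order k q Infty + (\<Sum>c\<in>S. zorder q c) = - 2 * int k"
    using section_order_Infty Ri_ord by simp
  also have "section_order k q Infty + (\<Sum>c\<in>S. zorder q c) =
      (\<Sum>x\<in>insert Infty (Aff ` S). section_order k q x)"
    using fin by (subst sum.insert) (auto simp: sum.reindex inj_on_def section_order_Aff)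
  also have "\<dots> = (\<Sum>x | section_order k q x \<noteq> 0. section_order k q x)"
    using fin section_order_support unfolding S_def
    by (intro sum.mono_neutral_right) auto
  finally show ?thesis .
qed

end

section \<open>Local degrees of a rational map\<close>

text \<open>
  For a point \<open>x\<close> of the sphere, \<open>num x\<close> and \<open>den x\<close> below are the numerator and denominator of \<open>f\<close>
  followed by the coordinate centred at \<open>x\<close>. The fibre over \<open>x\<close> consists of the roots of \<open>num x\<close>, when
  it is regarded as a polynomial of formal degree \<open>d\<close>, whose root at infinity has multiplicity
  \<open>d - degree (num x)\<close>. This treats finite and infinite points alike.
\<close>

locale rational_representation =
  fixes a b :: "complex poly" and d :: nat and f :: "riemann_sphere \<Rightarrow> riemann_sphere"
  assumes coprime: "coprime a b" and d_eq: "d = max (degree a) (degree b)" and d_pos: "d > 0"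
    and f_Aff: "\<And>z. f (Aff z) = (if poly b z = 0 then Infty else Aff (poly a z / poly b z))"
    and f_Infty: "f Infty = (if coeff b d = 0 then Infty else Aff (coeff a d / coeff b d))"
begin

definition num :: "riemann_sphere \<Rightarrow> complex poly" where
  "num x = (case x of Aff c \<Rightarrow> a - smult c b | Infty \<Rightarrow> b)"

definition den :: "riemann_sphere \<Rightarrow> complex poly" where
  "den x = (case x of Aff c \<Rightarrow> b | Infty \<Rightarrow> a)"

definition multiplicity_at :: "riemann_sphere \<Rightarrow> nat" where
  "multiplicity_at y = (case y of Aff z \<Rightarrow> order z (num (f y)) | Infty \<Rightarrow> d - degree (num (f y)))"

lemma no_common_root: "\<not> (poly a z = 0 \<and> poly b z = 0)"
proof
  assume "poly a z = 0 \<and> poly b z = 0"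
  hence "[:-z, 1:] dvd a" "[:-z, 1:] dvd b" by (auto simp: poly_eq_0_iff_dvd)
  hence "[:-z, 1:] dvd 1" using coprime by (metis coprime_common_divisor)
  thus False using poly_eq_0_iff_dvd[of 1 z] by simp
qed

lemma coeff_d: "coeff a d \<noteq> 0 \<or> coeff b d \<noteq> 0"
  using d_eq d_pos by (cases "degree a \<le> degree b") (auto simp: max_def)

lemma num_nonzero: "num x \<noteq> 0"
proof
  assume "num x = 0"
  then consider "b = 0" | c where "a = smult c b" by (auto simp: num_def split: riemann_sphere.splits)
  hence "degree a = 0 \<and> degree b = 0"
  proof cases
    case 1
    hence "is_unit a" using coprime by simp
    moreover from this have "a \<noteq> 0" by auto
    ultimately show ?thesis using 1 by (simp add: is_unit_iff_degree)
  next
    case 2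
    hence "is_unit b" using coprime by (metis coprime_common_divisor dvd_refl dvd_smult)
    moreover from this have "b \<noteq> 0" by auto
    ultimately have "degree b = 0" by (simp add: is_unit_iff_degree)
    thus ?thesis using 2 by simp
  qed
  thus False using d_eq d_pos by simp
qed

lemma degree_num: "degree (num x) \<le> d"
  unfolding num_def using d_eq by (auto split: riemann_sphere.splits intro!: degree_diff_le)

lemma degree_den: "degree (den x) \<le> d"
  unfolding den_def using d_eq by (auto split: riemann_sphere.splits)

lemma f_Aff_eq_iff: "f (Aff z) = x \<longleftrightarrow> poly (num x) z = 0"
  using no_common_root[of z]
  by (cases x) (auto simp: f_Aff num_def field_simps)

lemma f_Infty_eq_iff: "f Infty = x \<longleftrightarrow> coeff (num x) d = 0"
  using coeff_d by (cases x) (auto simp: f_Infty num_def field_simps)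

lemma den_Aff_nonzero: "poly (den (f (Aff z))) z \<noteq> 0"
  using no_common_root[of z] by (auto simp: f_Aff den_def)

lemma den_Infty_nonzero: "coeff (den (f Infty)) d \<noteq> 0"
  using coeff_d by (auto simp: f_Infty den_def)

lemma surj: "surj f"
proof -
  have "\<exists>y. f y = x" for x
  proof (cases "degree (num x) = 0")
    case True
    hence "coeff (num x) d = 0" using d_pos by (simp add: coeff_eq_0)
    thus ?thesis using f_Infty_eq_iff by blast
  next
    case False
    hence "\<exists>z. poly (num x) z = 0"
      by (intro alg_closed_imp_poly_has_root) simp
    thus ?thesis using f_Aff_eq_iff by blast
  qed
  thus ?thesis by (metis surjI)
qed

lemma multiplicity_at_pos: "multiplicity_at y > 0"
proof (cases y)
  case (Aff z)
  have "poly (num (f y)) z = 0" using f_Aff_eq_iff Aff by blast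
  thus ?thesis using num_nonzero by (auto simp: multiplicity_at_def Aff order_root)
next
  case Infty
  have "coeff (num (f y)) d = 0" using f_Infty_eq_iff Infty by blast
  hence "degree (num (f y)) \<noteq> d" using num_nonzero[of "f y"] by (metis leading_coeff_0_iff)
  thus ?thesis using degree_num[of "f y"] by (simp add: multiplicity_at_def Infty)
qed

text \<open>
  The \<open>d\<close> roots of the numerator, counted with multiplicity and including infinity, form the fibre.
\<close>

lemma multiplicity_at_singleton_fibre:
  assumes "f -` {x} = {y}"
  shows "multiplicity_at y = d"
proof -
  have fy: "f y = x" and uniq: "f y' = x \<Longrightarrow> y' = y" for y' using assms by auto
  show ?thesis
  proof (cases y)
    case Infty
    have no_root: "poly (num x) z \<noteq> 0" for z using uniq[of "Aff z"] f_Aff_eq_iff[of z x] Infty by auto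
    have "degree (num x) = 0"
      using no_root alg_closed_imp_poly_has_root by blast
    thus ?thesis using fy Infty by (simp add: multiplicity_at_def)
  next
    case (Aff z)
    have "coeff (num x) d \<noteq> 0" using uniq[of Infty] f_Infty_eq_iff[of x] Aff by auto
    hence deg: "degree (num x) = d" using degree_num[of x] le_degree by (metis antisym)
    obtain r where r: "num x = [:-z, 1:] ^ order z (num x) * r" "\<not> [:-z, 1:] dvd r"
      using order_decomp[OF num_nonzero] by blast
    have "r \<noteq> 0" using r num_nonzero[of x] by auto
    have "poly r w \<noteq> 0" for w
    proof
      assume w: "poly r w = 0"
      hence "w \<noteq> z" using r by (auto simp: poly_eq_0_iff_dvd)
      moreover have "poly (num x) w = 0" using r(1) w by (metis mult_zero_right poly_mult)
      ultimately show False using uniq[of "Aff w"] f_Aff_eq_iff[of w x] Aff by auto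
    qed
    hence "degree r = 0" using alg_closed_imp_poly_has_root by blast
    moreover have "degree (num x) = order z (num x) + degree r"
      using \<open>r \<noteq> 0\<close> by (subst r(1)) (simp add: degree_mult_eq degree_power_eq)
    ultimately show ?thesis using deg fy Aff unfolding multiplicity_at_def by simp
  qed
qed

lemma coord_f:
  assumes "poly (den x) z \<noteq> 0"
  shows "coord x (f (Aff z)) = poly (num x) z / poly (den x) z"
  using assms by (cases x) (auto simp: f_Aff num_def den_def field_simps)

text \<open>
  Around a finite point the power of \<open>t\<close> is split off from the numerator; around infinity the
  numerator and the denominator are multiplied by \<open>t ^ d\<close>, which turns them into their reflected
  polynomials.
\<close>

lemma local_form:
  obtains u v where "poly u 0 \<noteq> 0" "poly v 0 \<noteq> 0"
    "\<And>t. poly v t \<noteq> 0 \<Longrightarrow>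
       coord (f y) (f (param y t)) = t ^ multiplicity_at y * poly u t / poly v t"
proof (cases y)
  case (Aff z)
  obtain r where r: "num (f y) = [:-z, 1:] ^ order z (num (f y)) * r" "\<not> [:-z, 1:] dvd r"
    using order_decomp[OF num_nonzero] by blast
  show ?thesis
  proof (rule that)
    show "poly (pcompose r [:z, 1:]) 0 \<noteq> 0" using r(2) by (simp add: poly_pcompose poly_eq_0_iff_dvd)
    show "poly (pcompose (den (f y)) [:z, 1:]) 0 \<noteq> 0"
      using den_Aff_nonzero[of z] by (simp add: poly_pcompose Aff)
    fix t assume "poly (pcompose (den (f y)) [:z, 1:]) t \<noteq> 0"
    hence "poly (den (f y)) (z + t) \<noteq> 0" by (simp add: poly_pcompose)
    moreover have "poly (num (f y)) (z + t) = t ^ order z (num (f y)) * poly r (z + t)"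
      by (subst r(1)) simp
    ultimately show "coord (f y) (f (param y t)) = t ^ multiplicity_at y *
        poly (pcompose r [:z, 1:]) t / poly (pcompose (den (f y)) [:z, 1:]) t"
      using coord_f[of "f y" "z + t"] by (simp add: Aff poly_pcompose multiplicity_at_def)
  qed
next
  case Infty
  define v where "v = monom 1 (d - degree (den (f y))) * reflect_poly (den (f y))"
  have v: "poly v t = t ^ d * poly (den (f y)) (inverse t)" if "t \<noteq> 0" for t
    using that degree_den[of "f y"]
    by (simp add: v_def poly_monom poly_reflect_poly_nz flip: power_add mult.assoc)
  have deg: "degree (den (f y)) = d" using den_Infty_nonzero degree_den[of "f y"]
    unfolding Infty by (metis antisym le_degree)
  show ?thesis
  proof (rule that)
    show "poly (reflect_poly (num (f y))) 0 \<noteq> 0" using num_nonzero by simp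
    show v0: "poly v 0 \<noteq> 0" using den_Infty_nonzero deg by (simp add: v_def Infty)
    fix t assume t: "poly v t \<noteq> 0"
    show "coord (f y) (f (param y t)) =
        t ^ multiplicity_at y * poly (reflect_poly (num (f y))) t / poly v t"
    proof (cases "t = 0")
      case True
      have "coord (f y) (f (param y t)) = 0" using True Infty by (cases "f y") auto
      thus ?thesis using True multiplicity_at_pos[of y] by simp
    next
      case False
      have "coord (f y) (f (param y t)) =
          poly (num (f y)) (inverse t) / poly (den (f y)) (inverse t)"
        using coord_f[of "f y" "inverse t"] t v False by (simp add: Infty)
      also have "\<dots> = t ^ d * poly (num (f y)) (inverse t) / poly v t"
        using v False by simp
      also have "t ^ d * poly (num (f y)) (inverse t) =
          t ^ multiplicity_at y * poly (reflect_poly (num (f y))) t"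
        using False degree_num[of "f y"]
        by (simp add: poly_reflect_poly_nz multiplicity_at_def Infty flip: power_add mult.assoc)
      finally show ?thesis .
    qed
  qed
qed

definition local_map :: "riemann_sphere \<Rightarrow> complex \<Rightarrow> complex" where
  "local_map y t = coord (f y) (f (param y t))"

lemma local_map_0 [simp]: "local_map y 0 = 0"
proof -
  have "param y 0 = y" "coord x x = 0" for x by (cases y; simp) (cases x; simp)
  thus ?thesis by (simp add: local_map_def)
qed

lemma local_map_analytic: "local_map y analytic_on {0}"
  and local_map_zorder: "zorder (local_map y) 0 = int (multiplicity_at y)"
  and local_map_nonzero: "eventually (\<lambda>t. local_map y t \<noteq> 0) (at 0)"
proof -
  obtain u v where uv: "poly u 0 \<noteq> 0" "poly v 0 \<noteq> 0"
    "\<And>t. poly v t \<noteq> 0 \<Longrightarrow> local_map y t = t ^ multiplicity_at y * poly u t / poly v t"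
    using local_form unfolding local_map_def by metis
  define S where "S = {t. poly u t \<noteq> 0 \<and> poly v t \<noteq> 0}"
  have "open S" unfolding S_def by (intro open_Collect_conj open_Collect_neq continuous_intros)
  have S: "0 \<in> S" "\<And>t. t \<in> S \<Longrightarrow> poly v t \<noteq> 0" "\<And>t. t \<in> S \<Longrightarrow> poly u t \<noteq> 0" using uv by (auto simp: S_def)
  have "(\<lambda>t. t ^ multiplicity_at y * poly u t / poly v t) holomorphic_on S"
    using S by (intro holomorphic_intros) auto
  hence "local_map y holomorphic_on S" by (rule holomorphic_transform) (use S uv in auto)
  thus "local_map y analytic_on {0}" using \<open>open S\<close> S(1) analytic_at by blast
  show "zorder (local_map y) 0 = int (multiplicity_at y)"
    by (rule zorder_eqI[of S 0 "\<lambda>t. poly u t / poly v t"])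
       (use \<open>open S\<close> S uv in \<open>auto intro!: holomorphic_intros\<close>)
  have "eventually (\<lambda>t. t \<in> S - {0}) (at 0)"
    using \<open>open S\<close> S(1) by (intro eventually_at_in_open) auto
  thus "eventually (\<lambda>t. local_map y t \<noteq> 0) (at 0)"
    by eventually_elim (use S uv in auto)
qed

lemma local_degree_eq: "local_degree f y = multiplicity_at y"
  using local_map_zorder[of y] unfolding local_map_def local_degree_def by simp

lemma has_field_derivative_affine_part:
  assumes "f (Aff z) \<noteq> Infty"
  shows "((\<lambda>z. affine_part (f (Aff z))) has_field_derivative
           deriv (\<lambda>z. affine_part (f (Aff z))) z) (at z)"
proof -
  have bz: "poly b z \<noteq> 0" using assms by (auto simp: f_Aff)
  have "open {z. poly b z \<noteq> 0}" by (intro open_Collect_neq continuous_intros)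
  hence "eventually (\<lambda>w. poly b w \<noteq> 0) (nhds z)" using bz eventually_nhds_in_open by force
  hence ev: "eventually (\<lambda>w. affine_part (f (Aff w)) = poly a w / poly b w) (nhds z)"
    by eventually_elim (simp add: f_Aff)
  have "(\<lambda>w. poly a w / poly b w) field_differentiable at z"
    using bz by (intro field_differentiable_divide)
      (auto simp: field_differentiable_def intro: poly_DERIV)
  then obtain D where "((\<lambda>w. poly a w / poly b w) has_field_derivative D) (at z)"
    unfolding field_differentiable_def by blast
  hence "((\<lambda>z. affine_part (f (Aff z))) has_field_derivative D) (at z)"
    using DERIV_cong_ev[OF refl ev refl] by blast
  thus ?thesis by (metis DERIV_imp_deriv)
qed

end

section \<open>Orders under pullback\<close>

text \<open>
  Equality of sections only concerns the plane, off a set that may accumulate at infinity. There the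
  two coefficients agree at points arbitrarily close to \<open>w = 0\<close>, and since both are meromorphic this
  forces equality near \<open>0\<close>.
\<close>

lemma section_eq_imp_local_coeff_eq:
  assumes eq: "section_eq q r"
    and mero: "local_coeff k q x meromorphic_on {0}" "local_coeff k r x meromorphic_on {0}"
  shows "eventually (\<lambda>t. local_coeff k q x t = local_coeff k r x t) (at 0)"
proof (cases x)
  case (Aff c)
  have "eventually (\<lambda>z. q z = r z) (at c)"
    using eq eventually_cosparse_imp_eventually_at unfolding section_eq_def by blast
  thus ?thesis by (simp add: Aff at_to_0' eventually_filtermap add.commute)
next
  case Infty
  define D where "D = (\<lambda>t. local_coeff k q x t - local_coeff k r x t)"
  have "D meromorphic_on {0}" unfolding D_def by (intro meromorphic_intros mero)
  moreover have "frequently (\<lambda>t. D t = 0) (at 0)"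
    unfolding frequently_at
  proof (intro allI impI)
    fix \<epsilon> :: real assume "\<epsilon> > 0"
    define w :: complex where "w = of_real (\<epsilon> / 2)"
    have w: "w \<in> ball 0 \<epsilon> - {0}" using \<open>\<epsilon> > 0\<close> by (simp add: w_def dist_norm)
    have "eventually (\<lambda>z. q z = r z) (at (inverse w))"
      using eq eventually_cosparse_imp_eventually_at unfolding section_eq_def by blast
    hence "eventually (\<lambda>v. q (inverse v) = r (inverse v)) (at w)"
      using filterlim_inverse_at[of w] w eventually_compose_filterlim by blast
    moreover have "eventually (\<lambda>v. v \<in> ball 0 \<epsilon> - {0} - {w}) (at w)"
      using w by (intro eventually_at_in_open) auto
    ultimately have "eventually (\<lambda>v. v \<in> ball 0 \<epsilon> - {0} \<and> q (inverse v) = r (inverse v)) (at w)"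
      by eventually_elim auto
    hence "\<exists>v. v \<in> ball 0 \<epsilon> - {0} \<and> q (inverse v) = r (inverse v)"
      using eventually_happens' at_neq_bot by blast
    thus "\<exists>v\<in>UNIV. v \<noteq> 0 \<and> dist v 0 < \<epsilon> \<and> D v = 0"
      by (auto simp: D_def Infty local_coeff_def dist_commute)
  qed
  ultimately have "eventually (\<lambda>t. D t = 0) (at 0)"
    by (intro not_essential_frequently_0_imp_eventually_0) (auto simp: meromorphic_at_iff)
  thus ?thesis by (simp add: D_def)
qed

lemma local_coeff_cmult: "local_coeff k (\<lambda>z. l * q z) x = (\<lambda>t. l * local_coeff k q x t)"
  by (simp add: local_coeff_def fun_eq_iff)

context rational_representation
begin

lemma local_map_field_derivative:
  "eventually (\<lambda>t. (local_map y has_field_derivative deriv (local_map y) t) (at t)) (at 0)"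
  using eventually_analytic_at[OF analytic_on_imp_meromorphic_on[OF local_map_analytic[of y]]]
  by eventually_elim (simp add: analytic_on_imp_differentiable_at field_differentiable_derivI)

text \<open>
  A nonzero value of the coordinate is never one of the default values that \<^const>\<open>coord\<close> takes
  where it is not meaningful, so the point can be recovered from it.
\<close>

lemma chart_local_map:
  assumes "t \<noteq> 0" "local_map y t \<noteq> 0"
  shows "f (Aff (chart y t)) = Aff (chart (f y) (local_map y t))"
proof -
  have py: "param y t = Aff (chart y t)" using assms(1) by (cases y) (auto simp: chart_def)
  have inv: "param x (coord x p) = Aff (chart x (coord x p)) \<and> p = param x (coord x p)"
    if "coord x p \<noteq> 0" for x p
    using that by (cases x; cases p) (auto simp: chart_def)
  show ?thesis using inv[of "f y" "f (param y t)"] assms(2)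
    unfolding local_map_def py by metis
qed

text \<open>
  Taking local coefficients commutes with pullback. This is the chain rule for the square formed by
  the charts at \<open>y\<close> and \<open>f y\<close>, the map \<open>f\<close> and its local expression.
\<close>

lemma local_coeff_pullback:
  "eventually (\<lambda>t. local_coeff k q (f y) (local_map y t) * deriv (local_map y) t ^ k =
     local_coeff k (pullback k f q) y t) (at 0)"
proof -
  define g where "g = (\<lambda>z. affine_part (f (Aff z)))"
  obtain S where S: "open S" "0 \<in> S" "\<And>t. t \<in> S \<Longrightarrow> t \<noteq> 0 \<Longrightarrow> local_map y t \<noteq> 0"
    using local_map_nonzero[of y] unfolding eventually_at_topological by blast
  have "eventually (\<lambda>t. t \<in> S - {0}) (at 0)" using S(1,2) by (intro eventually_at_in_open) auto
  thus ?thesis using local_map_field_derivative[of y]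
  proof eventually_elim
    case (elim t)
    have commute: "g (chart y s) = chart (f y) (local_map y s)" if "s \<in> S - {0}" for s
      using chart_local_map[of s y] S that by (simp add: g_def)
    have "((\<lambda>s. g (chart y s)) has_field_derivative
        deriv g (chart y t) * deriv (chart y) t) (at t)"
    proof (rule DERIV_chain2[where f = g and g = "chart y"])
      show "(g has_field_derivative deriv g (chart y t)) (at (chart y t))"
        unfolding g_def using chart_local_map[of t y] S elim
        by (intro has_field_derivative_affine_part) auto
    qed (use elim has_field_derivative_chart in auto)
    moreover have "((\<lambda>s. g (chart y s)) has_field_derivative
        deriv (chart (f y)) (local_map y t) * deriv (local_map y) t) (at t)"
    proof (rule has_field_derivative_transform_within_open[where S = "S - {0}"])
      show "((\<lambda>s. chart (f y) (local_map y s)) has_field_derivative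
          deriv (chart (f y)) (local_map y t) * deriv (local_map y) t) (at t)"
        using elim S by (intro DERIV_chain2[OF has_field_derivative_chart]) auto
      show "open (S - {0})" using S by auto
    qed (use elim commute in auto)
    ultimately have "deriv g (chart y t) * deriv (chart y) t =
        deriv (chart (f y)) (local_map y t) * deriv (local_map y) t"
      by (rule DERIV_unique)
    thus ?case
      using commute[of t] elim(1)
      by (simp add: local_coeff_def pullback_def Let_def g_def mult.assoc flip: power_mult_distrib)
  qed
qed

text \<open>
  If \<open>F\<close> vanishes to order \<open>e\<close> at \<open>0\<close>, then \<open>Q (F t) * F' t ^ k\<close> has order \<open>e * ord Q + k * (e - 1)\<close>;
  adding \<open>k\<close> makes this multiplicative in \<open>e\<close>.
\<close>

lemma section_order_pullback:
  assumes nonzero_sec: "nonzero_section k q" and k: "k \<ge> 1" and l: "l \<noteq> 0"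
    and eigen: "section_eq (pullback k f q) (\<lambda>z. l * q z)"
  shows "section_order k q y + int k = int (local_degree f y) * (section_order k q (f y) + int k)"
proof -
  interpret nonzero_section k q by fact
  define F where "F = local_map y"
  define Q where "Q = local_coeff k q (f y)"
  have F: "F analytic_on {0}" "F 0 = 0" "eventually (\<lambda>t. F t \<noteq> 0) (at 0)"
    unfolding F_def using local_map_analytic local_map_nonzero by auto
  have Q: "Q meromorphic_on {0}" "eventually (\<lambda>t. Q t \<noteq> 0) (at 0)"
    unfolding Q_def using local_coeff_meromorphic eventually_local_coeff_nonzero by auto
  have ordF: "zorder F 0 = int (local_degree f y)" "zorder F 0 > 0"
    unfolding F_def using local_map_zorder[of y] local_degree_eq[of y] multiplicity_at_pos[of y] by auto
  have meroF: "F meromorphic_on {0}" using F(1) by (rule analytic_on_imp_meromorphic_on)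
  have meroQF: "(\<lambda>t. Q (F t)) meromorphic_on {0}"
    by (rule meromorphic_on_compose[OF Q(1) F(1)]) (use F(2) in auto)
  have meroD: "deriv F meromorphic_on {0}" using meroF by (rule meromorphic_on_deriv)
  have pb: "eventually (\<lambda>t. Q (F t) * deriv F t ^ k = local_coeff k (pullback k f q) y t) (at 0)"
    unfolding Q_def F_def by (rule local_coeff_pullback)
  have "local_coeff k (pullback k f q) y meromorphic_on {0} \<longleftrightarrow>
      (\<lambda>t. Q (F t) * deriv F t ^ k) meromorphic_on {0}"
    by (rule meromorphic_on_cong) (use pb in \<open>auto elim!: eventually_mono\<close>)
  hence "local_coeff k (pullback k f q) y meromorphic_on {0}"
    using meroQF meroD by (auto intro!: meromorphic_intros)
  moreover have "local_coeff k (\<lambda>z. l * q z) y meromorphic_on {0}"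
    unfolding local_coeff_cmult by (intro meromorphic_intros local_coeff_meromorphic)
  ultimately have "eventually (\<lambda>t. local_coeff k (pullback k f q) y t = l * local_coeff k q y t) (at 0)"
    using section_eq_imp_local_coeff_eq[OF eigen] unfolding local_coeff_cmult by blast
  with pb have ev: "eventually (\<lambda>t. Q (F t) * deriv F t ^ k = l * local_coeff k q y t) (at 0)"
    by eventually_elim simp
  have nz: "eventually (\<lambda>t. Q (F t) * deriv F t ^ k \<noteq> 0) (at 0)"
    using ev eventually_local_coeff_nonzero[of y] by eventually_elim (use l in simp)
  have nzQF: "\<exists>\<^sub>F t in at 0. Q (F t) \<noteq> 0" and nzD: "\<exists>\<^sub>F t in at 0. deriv F t \<noteq> 0"
    and nzDk: "\<exists>\<^sub>F t in at 0. deriv F t ^ k \<noteq> 0"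
    by (rule eventually_frequently, simp, use nz in eventually_elim, use k in auto)+
  have "section_order k q y = zorder (\<lambda>t. l * local_coeff k q y t) 0"
    unfolding section_order_def using l by (simp add: zorder_cmult)
  also have "\<dots> = zorder (\<lambda>t. Q (F t) * deriv F t ^ k) 0"
    by (rule zorder_cong) (use ev in \<open>auto elim!: eventually_mono\<close>)
  also have "\<dots> = zorder (\<lambda>t. Q (F t)) 0 + zorder (\<lambda>t. deriv F t ^ k) 0"
    by (intro zorder_mult meroQF meromorphic_intros meroD nzQF nzDk)
  also have "zorder (\<lambda>t. deriv F t ^ k) 0 = int k * (zorder F 0 - 1)"
  proof -
    have "zorder (deriv F) 0 = zorder F 0 - 1"
      using meroF F(3) ordF(2)
      by (intro zorder_deriv_minus_1) (auto simp: meromorphic_at_iff eventually_frequently)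
    thus ?thesis using zorder_power[OF meroD nzD] by simp
  qed
  also have "zorder (\<lambda>t. Q (F t)) 0 = zorder Q 0 * zorder F 0"
    using zorder_compose'[of Q F 0] Q F by (simp add: o_def meromorphic_at_iff)
  finally show ?thesis
    using ordF(1) by (simp add: section_order_def Q_def algebra_simps)
qed

end

section \<open>Multiplicative functions along a branched self-map\<close>

text \<open>
  The contribution of a point of weight \<open>n\<close> to the deficit of the Euler characteristic from \<open>2\<close>.
\<close>

definition weight_defect :: "enat \<Rightarrow> real" where
  "weight_defect n = 1 - (case n of enat m \<Rightarrow> 1 / real m | \<infinity> \<Rightarrow> 0)"

lemma weight_defect_simps [simp]:
  "weight_defect (enat n) = 1 - 1 / real n" "weight_defect \<infinity> = 1"
  by (simp_all add: weight_defect_def)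

text \<open>
  The properties of a rational map of degree at least two, with its local degrees \<open>e\<close>, and of the
  shifted orders \<open>m\<close> of an invariant section that the construction of the orbifold rests on.
\<close>

locale branched_self_map =
  fixes f :: "'a \<Rightarrow> 'a" and e :: "'a \<Rightarrow> nat" and m :: "'a \<Rightarrow> int" and k :: nat
  assumes surj: "surj f"
    and e_pos: "\<And>y. e y \<ge> 1"
    and singleton_fibre: "\<And>x y. f -` {x} = {y} \<Longrightarrow> e y > 1"
    and m_eq: "\<And>y. m y = int (e y) * m (f y)"
    and k_pos: "k \<ge> 1"
    and finite_m: "finite {x. m x \<noteq> int k}"
begin

text \<open>
  Surjectivity makes \<open>f\<close> map \<open>f\<^sup>-\<^sup>1 S\<close> onto \<open>S\<close>, so counting gives \<open>f\<^sup>-\<^sup>1 S = S\<close> and injectivity on \<open>S\<close>: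
  the fibres over \<open>S\<close> are singletons.
\<close>

lemma backward_invariant:
  assumes "finite S" "f -` S \<subseteq> S" "x \<in> S"
  shows "m x = 0" "\<exists>y. f y = x \<and> e y > 1"
proof -
  have image: "f ` (f -` S) = S" using surj by (simp add: image_vimage_eq)
  have fin: "finite (f -` S)" using assms finite_subset by blast
  have "card S \<le> card (f -` S)" using card_image_le[OF fin, of f] image by simp
  hence eq: "f -` S = S" using assms by (intro card_seteq) auto
  have inj: "inj_on f S" using image eq assms(1) by (intro eq_card_imp_inj_on) auto
  have totally_ramified: "\<exists>y. f y = x \<and> y \<in> S \<and> e y > 1" if "x \<in> S" for x
  proof -
    obtain y where y: "f y = x" using surjD[OF surj, of x] by metis
    have "y' = y" if "f y' = x" for y'
      using inj_onD[OF inj, of y' y] y that \<open>x \<in> S\<close> eq by blast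
    hence "f -` {x} = {y}" using y by blast
    thus ?thesis using singleton_fibre y that eq by blast
  qed
  \<comment> \<open>Going backwards at least doubles \<open>\<bar>m\<bar>\<close>, so its maximum on \<open>S\<close> vanishes.\<close>
  define K where "K = Max ((\<lambda>x. \<bar>m x\<bar>) ` S)"
  have "K \<in> (\<lambda>x. \<bar>m x\<bar>) ` S" unfolding K_def using assms by (intro Max_in) auto
  then obtain z where z: "z \<in> S" "K = \<bar>m z\<bar>" by auto
  obtain y where y: "f y = z" "y \<in> S" "e y > 1" using totally_ramified z by blast
  have "2 * K \<le> int (e y) * \<bar>m z\<bar>" using y z by (intro mult_mono) auto
  also have "\<dots> = \<bar>m y\<bar>" using m_eq[of y] y by (simp add: abs_mult)
  also have "\<dots> \<le> K" unfolding K_def using y assms by (intro Max_ge) auto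
  finally have "K \<le> 0" by simp
  moreover have "\<bar>m x\<bar> \<le> K" unfolding K_def using assms by (intro Max_ge) auto
  ultimately show "m x = 0" by simp
  show "\<exists>y. f y = x \<and> e y > 1" using totally_ramified assms(3) by blast
qed

text \<open>The finite set \<open>{m < 0}\<close> contains its preimage, since \<open>e\<close> is positive.\<close>

lemma m_nonneg: "m x \<ge> 0"
proof (rule ccontr)
  assume "\<not> m x \<ge> 0"
  have "finite {x. m x < 0}" by (rule finite_subset[OF _ finite_m]) auto
  moreover have "f -` {x. m x < 0} \<subseteq> {x. m x < 0}"
  proof safe
    fix y assume "m (f y) < 0"
    thus "m y < 0" using m_eq[of y] e_pos[of y] by (simp add: mult_pos_neg)
  qed
  ultimately have "m x = 0" using \<open>\<not> m x \<ge> 0\<close> by (intro backward_invariant(1)) auto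
  thus False using \<open>\<not> m x \<ge> 0\<close> by simp
qed

definition postcritical :: "'a set" where
  "postcritical = (\<Union>n\<in>{0<..}. (f ^^ (n :: nat)) ` {y. e y > 1})"

lemma image_postcritical:
  assumes "x \<in> postcritical"
  shows "f x \<in> postcritical"
proof -
  obtain n y where "n > 0" "e y > 1" "x = (f ^^ n) y"
    using assms by (auto simp: postcritical_def)
  hence "f x = (f ^^ Suc n) y" by simp
  thus ?thesis using \<open>e y > 1\<close> unfolding postcritical_def by blast
qed

lemma image_critical: "e y > 1 \<Longrightarrow> f y \<in> postcritical"
  unfolding postcritical_def by (auto intro!: bexI[of _ 1])

text \<open>
  Along an orbit \<open>m\<close> is divided by the local degrees, so its value drops only past a critical point.
\<close>

lemma iterate_dvd_postcritical:
  fixes n :: nat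
  shows "m ((f ^^ n) y) dvd m y \<and> (m ((f ^^ n) y) \<noteq> m y \<longrightarrow> (f ^^ n) y \<in> postcritical)"
proof (induction n)
  case (Suc n)
  let ?z = "(f ^^ n) y"
  have "m (f ?z) dvd m ?z" using m_eq[of ?z] by simp
  moreover have "f ?z \<in> postcritical" if "m (f ?z) \<noteq> m y"
  proof (cases "m ?z = m y")
    case True
    hence "e ?z \<noteq> 1" using m_eq[of ?z] that by auto
    hence "e ?z > 1" using e_pos[of ?z] by simp
    thus ?thesis by (rule image_critical)
  next
    case False
    thus ?thesis using Suc image_postcritical by blast
  qed
  ultimately show ?case using Suc by (auto intro: dvd_trans)
qed auto

text \<open>
  The backward orbit of \<open>x\<close> meets \<open>{m = k}\<close>: otherwise it would be finite, hence \<open>m x = 0\<close>.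
\<close>

lemma m_dvd_postcritical:
  assumes "m x > 0"
  shows "m x dvd int k" "m x \<noteq> int k \<Longrightarrow> x \<in> postcritical"
proof -
  define T where "T = {y. \<exists>n :: nat. (f ^^ n) y = x}"
  have "\<exists>y\<in>T. m y = int k"
  proof (rule ccontr)
    assume "\<not> (\<exists>y\<in>T. m y = int k)"
    hence "finite T" by (intro finite_subset[OF _ finite_m]) auto
    moreover have "f -` T \<subseteq> T"
    proof safe
      fix y assume "f y \<in> T"
      then obtain n :: nat where "(f ^^ n) (f y) = x" by (auto simp: T_def)
      hence "(f ^^ Suc n) y = x" by (simp add: funpow_swap1)
      thus "y \<in> T" unfolding T_def by blast
    qed
    moreover have "x \<in> T" unfolding T_def by (auto intro: exI[of _ 0])
    ultimately have "m x = 0" by (rule backward_invariant(1))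
    thus False using assms by simp
  qed
  then obtain y and n :: nat where y: "(f ^^ n) y = x" "m y = int k" unfolding T_def by blast
  show "m x dvd int k" "m x \<noteq> int k \<Longrightarrow> x \<in> postcritical"
    using iterate_dvd_postcritical[of n y] unfolding y by blast+
qed

lemma zero_postcritical:
  assumes "m x = 0"
  shows "x \<in> postcritical"
proof -
  have "finite {x. m x = 0}" using k_pos by (intro finite_subset[OF _ finite_m]) auto
  moreover have "f -` {x. m x = 0} \<subseteq> {x. m x = 0}"
  proof safe
    fix y assume "m (f y) = 0"
    thus "m y = 0" using m_eq[of y] by simp
  qed
  ultimately obtain y where "f y = x" "e y > 1" using backward_invariant(2) assms by blast
  thus ?thesis using image_critical by blast
qed

lemma postcritical_if_exceptional: "m x \<noteq> int k \<Longrightarrow> x \<in> postcritical"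
  using m_dvd_postcritical(2)[of x] zero_postcritical[of x] m_nonneg[of x] by linarith

definition weight :: "'a \<Rightarrow> enat" where
  "weight x = (if m x = 0 then \<infinity> else enat (nat (int k div m x)))"

lemma weight_cases:
  obtains "m x = 0" "weight x = \<infinity>"
  | n where "weight x = enat n" "n \<ge> 1" "int k = int n * m x" "m x > 0"
proof (cases "m x = 0")
  case False
  hence pos: "m x > 0" using m_nonneg[of x] by simp
  then obtain r where r: "int k = m x * r" using m_dvd_postcritical(1) by (auto elim: dvdE)
  hence "r > 0" using k_pos pos by (metis of_nat_0_less_iff less_le_trans zero_less_one zero_less_mult_pos)
  thus ?thesis using that(2)[of "nat r"] r pos by (auto simp: weight_def)
qed (use that in \<open>auto simp: weight_def\<close>)

lemma weight_ge_1: "weight x \<ge> 1"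
  by (cases x rule: weight_cases) (auto simp: one_enat_def)

lemma weight_eq_1_iff: "weight x = 1 \<longleftrightarrow> m x = int k"
  by (cases x rule: weight_cases) (use k_pos in \<open>auto simp: one_enat_def\<close>)

lemma weight_image: "weight (f y) = weight y * enat (e y)"
proof (cases y rule: weight_cases)
  case 1
  hence "m (f y) = 0" using m_eq[of y] e_pos[of y] by simp
  thus ?thesis using 1 e_pos[of y] by (simp add: weight_def imult_infinity enat_0_iff)
next
  case (2 n)
  hence pos: "m (f y) > 0" using m_eq[of y] m_nonneg[of "f y"] by (cases "m (f y) = 0") auto
  have "int k = int (n * e y) * m (f y)" using 2 m_eq[of y] by simp
  thus ?thesis using 2 pos by (simp add: weight_def flip: of_nat_mult)
qed

lemma weight_defect_weight: "weight_defect (weight x) = 1 - real_of_int (m x) / real k"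
proof (cases x rule: weight_cases)
  case (2 n)
  have "real k = real n * real_of_int (m x)" using 2(3) by (metis of_int_mult of_int_of_nat_eq)
  thus ?thesis using 2 by (simp add: field_simps)
qed auto

end

section \<open>Weights with total defect two\<close>

lemma weight_defect_bounds:
  assumes "n \<ge> 2"
  shows "1 / 2 \<le> weight_defect n" "weight_defect n \<le> 1"
proof -
  have "1 / 2 \<le> weight_defect n \<and> weight_defect n \<le> 1"
    using assms by (cases n) (auto simp: numeral_eq_enat field_simps)
  thus "1 / 2 \<le> weight_defect n" "weight_defect n \<le> 1" by auto
qed

lemma weight_defect_eq_1D: "weight_defect n = 1 \<Longrightarrow> n \<ge> 2 \<Longrightarrow> n = \<infinity>"
  by (cases n) (auto simp: numeral_eq_enat field_simps)

lemma weight_defect_eq_halfD: "weight_defect n = 1 / 2 \<Longrightarrow> n = 2"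
  by (cases n) (auto simp: numeral_eq_enat field_simps)

text \<open>The largest of the three summands is at least \<open>1 / 3\<close>, which bounds \<open>a\<close>, and then \<open>b\<close>.\<close>

lemma inverse_sum_eq_1_cases:
  fixes a b c :: nat
  assumes "2 \<le> a" "a \<le> b" "b \<le> c" "1 / real a + 1 / real b + 1 / real c = 1"
  shows "(a, b, c) \<in> {(3, 3, 3), (2, 4, 4), (2, 3, 6)}"
proof -
  have pos: "a > 0" "b > 0" "c > 0" using assms by auto
  have cb: "1 / real c \<le> 1 / real b" and ba: "1 / real b \<le> 1 / real a"
    using assms pos by (auto intro!: divide_left_mono)
  have eq: "b * c + a * c + a * b = a * b * c"
  proof -
    have "real (b * c + a * c + a * b) = real (a * b * c)"
      using assms(4) pos by (simp add: field_simps)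
    thus ?thesis using of_nat_eq_iff by blast
  qed
  have "1 \<le> 3 / real a" using cb ba assms(4) by simp
  hence "a \<le> 3" using pos by (simp add: field_simps)
  hence "a = 2 \<or> a = 3" using assms(1) by auto
  thus ?thesis
  proof
    assume a: "a = 2"
    have "1 / 2 \<le> 2 / real b" using cb assms(4) a by simp
    hence "b \<le> 4" using pos by (simp add: field_simps)
    hence "b = 2 \<or> b = 3 \<or> b = 4" using assms(2) a by auto
    thus ?thesis using eq a by auto
  next
    assume a: "a = 3"
    have "2 / 3 \<le> 2 / real b" using cb assms(4) a by simp
    hence "b \<le> 3" using pos by (simp add: field_simps)
    hence "b = 3" using assms(2) a by auto
    thus ?thesis using eq a by auto
  qed
qed

text \<open>
  Each defect lies between \<open>1 / 2\<close> and \<open>1\<close>, so there are two, three or four weights. Two weights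
  must both be infinite, four weights must all be \<open>2\<close>, and three weights either contain \<open>\<infinity>\<close> or
  solve \<open>1 / a + 1 / b + 1 / c = 1\<close>.
\<close>

lemma parabolic_weights_cases:
  fixes M :: "enat multiset"
  assumes ge: "\<And>n. n \<in># M \<Longrightarrow> n \<ge> 2" and sum: "(\<Sum>n\<in>#M. weight_defect n) = 2"
  shows "M \<in> {{#\<infinity>, \<infinity>#}, {#2, 2, \<infinity>#}, {#2, 2, 2, 2#}, {#3, 3, 3#}, {#2, 4, 4#}, {#2, 3, 6#}}"
proof -
  define xs where "xs = sorted_list_of_multiset M"
  have M: "M = mset xs" and sorted: "sorted xs" by (simp_all add: xs_def)
  have ge2: "n \<ge> 2" if "n \<in> set xs" for n using ge that M by auto
  have sum': "(\<Sum>n\<leftarrow>xs. weight_defect n) = 2"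
    using sum M by (simp flip: sum_mset_sum_list)
  have bounds: "real (length ys) / 2 \<le> (\<Sum>n\<leftarrow>ys. weight_defect n) \<and>
                (\<Sum>n\<leftarrow>ys. weight_defect n) \<le> real (length ys)"
    if "set ys \<subseteq> set xs" for ys
    using that
  proof (induction ys)
    case (Cons n ys)
    thus ?case using weight_defect_bounds[of n] ge2[of n] by (auto simp: field_simps)
  qed auto
  have "length xs \<ge> 2" "length xs \<le> 4" using bounds[of xs] sum' by auto
  hence "length xs = 2 \<or> length xs = 3 \<or> length xs = 4" by auto
  thus ?thesis
  proof (elim disjE)
    assume "length xs = 2"
    then obtain a b where xs: "xs = [a, b]"
      by (auto simp: length_Suc_conv numeral_eq_Suc)
    have "weight_defect a = 1" "weight_defect b = 1"
      using weight_defect_bounds[of a] weight_defect_bounds[of b] ge2 sum' by (auto simp: xs)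
    hence "a = \<infinity>" "b = \<infinity>" using ge2 by (auto simp: xs intro!: weight_defect_eq_1D)
    thus ?thesis by (simp add: M xs)
  next
    assume "length xs = 4"
    then obtain a b c e where xs: "xs = [a, b, c, e]"
      by (auto simp: length_Suc_conv numeral_eq_Suc)
    have "weight_defect a = 1 / 2" "weight_defect b = 1 / 2"
         "weight_defect c = 1 / 2" "weight_defect e = 1 / 2"
      using weight_defect_bounds[of a] weight_defect_bounds[of b]
        weight_defect_bounds[of c] weight_defect_bounds[of e] ge2 sum' by (auto simp: xs)
    hence "a = 2" "b = 2" "c = 2" "e = 2" by (blast dest: weight_defect_eq_halfD)+
    thus ?thesis by (simp add: M xs)
  next
    assume "length xs = 3"
    then obtain a b c where xs: "xs = [a, b, c]"
      by (auto simp: length_Suc_conv numeral_eq_Suc)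
    have le: "a \<le> b" "b \<le> c" "a \<ge> 2" "b \<ge> 2" using sorted ge2 by (auto simp: xs)
    show ?thesis
    proof (cases c)
      case infinity
      hence "weight_defect a = 1 / 2" "weight_defect b = 1 / 2"
        using weight_defect_bounds[of a] weight_defect_bounds[of b] le sum' by (auto simp: xs)
      hence "a = 2" "b = 2" by (blast dest: weight_defect_eq_halfD)+
      thus ?thesis using infinity by (simp add: M xs)
    next
      case (enat c')
      then obtain b' where b': "b = enat b'" using le by (cases b) auto
      then obtain a' where a': "a = enat a'" using le by (cases a) auto
      have "(a', b', c') \<in> {(3, 3, 3), (2, 4, 4), (2, 3, 6)}"
        using le sum' by (intro inverse_sum_eq_1_cases) (auto simp: xs enat a' b' numeral_eq_enat)
      thus ?thesis by (auto simp: M xs enat a' b' numeral_eq_enat)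
    qed
  qed
qed

section \<open>The invariant orbifold\<close>

theorem lemma3p5:
  fixes f :: "riemann_sphere \<Rightarrow> riemann_sphere"
    and d k :: nat
    and l :: complex
    and q :: "complex \<Rightarrow> complex"
  assumes "rational_map d f" and "d > 1"
    and "k \<ge> 1" and "l \<noteq> 0"
    and "meromorphic_section k q"
    and "\<not> section_eq q (\<lambda>_. 0)"
    and "section_eq (pullback k f q) (\<lambda>z. l * q z)"
  shows "\<exists>\<nu>. preserves_orbifold f \<nu> \<and> parabolic \<nu> \<and>
           orbifold_weights \<nu> \<in>
             {{#\<infinity>, \<infinity>#}, {#2, 2, \<infinity>#}, {#2, 2, 2, 2#}, {#3, 3, 3#}, {#2, 4, 4#}, {#2, 3, 6#}}"
proof -
  obtain a b where "rational_representation a b d f"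
    using assms(1,2) unfolding rational_map_def rational_representation_def by auto
  then interpret R: rational_representation a b d f .
  interpret Q: nonzero_section k q using assms(5,6) by unfold_locales
  define m where "m = (\<lambda>x. section_order k q x + int k)"
  interpret M: branched_self_map f "local_degree f" m k
  proof
    show "surj f" by (rule R.surj)
    show "local_degree f y \<ge> 1" for y using R.multiplicity_at_pos[of y] by (simp add: R.local_degree_eq)
    show "local_degree f y > 1" if "f -` {x} = {y}" for x y
      using R.multiplicity_at_singleton_fibre[OF that] assms(2) by (simp add: R.local_degree_eq)
    show "m y = int (local_degree f y) * m (f y)" for y
      unfolding m_def using assms by (intro R.section_order_pullback Q.nonzero_section_axioms)
    show "finite {x. m x \<noteq> int k}" using Q.finite_section_order by (simp add: m_def)
  qed (use assms in auto)
  define \<nu> where "\<nu> = M.weight"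
  have support: "{x. \<nu> x \<noteq> 1} = {x. section_order k q x \<noteq> 0}"
    unfolding \<nu>_def M.weight_eq_1_iff by (simp add: m_def)
  have "(\<Sum>x | \<nu> x \<noteq> 1. weight_defect (\<nu> x)) =
      (\<Sum>x | section_order k q x \<noteq> 0. - real_of_int (section_order k q x) / real k)"
    unfolding support using assms(3)
    unfolding \<nu>_def M.weight_defect_weight by (intro sum.cong) (auto simp: m_def field_simps)
  also have "\<dots> = - real_of_int (\<Sum>x | section_order k q x \<noteq> 0. section_order k q x) / real k"
    by (simp add: sum_negf flip: sum_divide_distrib)
  also have "\<dots> = 2" using assms(3) by (simp add: Q.sum_section_order)
  finally have total: "(\<Sum>x | \<nu> x \<noteq> 1. weight_defect (\<nu> x)) = 2" .
  have "preserves_orbifold f \<nu>"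
  proof -
    have "\<nu> x = 1" if "x \<notin> postcritical_set f" for x
      using that M.postcritical_if_exceptional[of x] M.weight_eq_1_iff[of x]
      unfolding \<nu>_def M.postcritical_def postcritical_set_def ramification_points_def by blast
    thus ?thesis unfolding preserves_orbifold_def using M.weight_ge_1 M.weight_image
      by (auto simp: \<nu>_def)
  qed
  moreover have "parabolic \<nu>"
    using total by (simp add: parabolic_def euler_characteristic_def weight_defect_def)
  moreover have "orbifold_weights \<nu> \<in>
      {{#\<infinity>, \<infinity>#}, {#2, 2, \<infinity>#}, {#2, 2, 2, 2#}, {#3, 3, 3#}, {#2, 4, 4#}, {#2, 3, 6#}}"
  proof (rule parabolic_weights_cases)
    have fin: "finite {x. \<nu> x \<noteq> 1}" unfolding support by (rule Q.finite_section_order)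
    show "n \<ge> 2" if n: "n \<in># orbifold_weights \<nu>" for n
    proof -
      obtain x where "n = \<nu> x" "\<nu> x \<noteq> 1" using n fin by (auto simp: orbifold_weights_def)
      moreover have "\<nu> x \<ge> 1" unfolding \<nu>_def by (rule M.weight_ge_1)
      ultimately show ?thesis by (cases "\<nu> x") (auto simp: numeral_eq_enat one_enat_def)
    qed
    show "(\<Sum>n\<in>#orbifold_weights \<nu>. weight_defect n) = 2"
      using total by (simp add: orbifold_weights_def sum_unfold_sum_mset multiset.map_comp o_def)
  qed
  ultimately show ?thesis by blast
qed

end
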